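(* For every integer $n\ge 1$, the matrix ring over dual numbers $M_n(\mathbb{D})$ is a strongly $r$-clean ring.
   Context: $\mathbb{D}=\{a+b\epsilon \mid a,b\in\mathbb{R},\ \epsilon^2=0\}$ is the ring of dual numbers, and $M_n(\mathbb{D})$ is the ring of $n\times n$ matrices over $\mathbb{D}$. An element $r$ of a ring $R$ (associative with identity) is von Neumann regular if $r=rxr$ for some $x\in R$. An element $a\in R$ is strongly $r$-clean if $a=r+e$ with $r\in R$ von Neumann regular, $e\in R$ idempotent, and $re=er$. A ring is strongly $r$-clean if every element of it is strongly $r$-clean. *)

theory Defs
  imports Complex_Main "HOL-Algebra.Ring" "Jordan_Normal_Form.Matrix"
begin

text \<open>Dual numbers: \<open>Dual a b\<close> stands for \<open>a + b \<epsilon>\<close> with \<open>\<epsilon>\<^sup>2 = 0\<close>;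
  see the lemmas \<open>dual_eps_square\<close> and \<open>Dual_eq\<close> below.\<close>

datatype dual_number = Dual (std_part: real) (eps_part: real)

lemma dual_number_eq_iff: "x = y \<longleftrightarrow> std_part x = std_part y \<and> eps_part x = eps_part y"
  by (auto intro: dual_number.expand)

instantiation dual_number :: comm_ring_1
begin

definition "0 = Dual 0 0"
definition "1 = Dual 1 0"
definition "x + y = Dual (std_part x + std_part y) (eps_part x + eps_part y)"
definition "- x = Dual (- std_part x) (- eps_part x)"
definition "x - y = Dual (std_part x - std_part y) (eps_part x - eps_part y)"
definition "x * y = Dual (std_part x * std_part y)
                         (std_part x * eps_part y + eps_part x * std_part y)"

instance
  by standard
    (simp_all add: zero_dual_number_def one_dual_number_def plus_dual_number_def
      uminus_dual_number_def minus_dual_number_def times_dual_number_def algebra_simps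
      dual_number_eq_iff)

end

instantiation dual_number :: real_algebra_1
begin

definition "scaleR r x = Dual (r * std_part x) (r * eps_part x)"

instance
  by standard
    (simp_all add: scaleR_dual_number_def plus_dual_number_def times_dual_number_def
      algebra_simps dual_number_eq_iff)

end

definition dual_eps :: dual_number where
  "dual_eps = Dual 0 1"

lemma dual_eps_square: "dual_eps ^ 2 = 0"
  by (simp add: dual_eps_def power2_eq_square times_dual_number_def zero_dual_number_def)

lemma Dual_eq: "Dual a b = of_real a + of_real b * dual_eps"
  by (simp add: dual_eps_def of_real_def scaleR_dual_number_def plus_dual_number_def
      times_dual_number_def one_dual_number_def)


definition von_neumann_regular :: "('a, 'm) ring_scheme \<Rightarrow> 'a \<Rightarrow> bool" where
  "von_neumann_regular R r \<longleftrightarrow>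
     r \<in> carrier R \<and> (\<exists>x\<in>carrier R. r = r \<otimes>\<^bsub>R\<^esub> x \<otimes>\<^bsub>R\<^esub> r)"

definition idempotent_elem :: "('a, 'm) ring_scheme \<Rightarrow> 'a \<Rightarrow> bool" where
  "idempotent_elem R e \<longleftrightarrow> e \<in> carrier R \<and> e \<otimes>\<^bsub>R\<^esub> e = e"

definition strongly_r_clean_elem :: "('a, 'm) ring_scheme \<Rightarrow> 'a \<Rightarrow> bool" where
  "strongly_r_clean_elem R a \<longleftrightarrow>
     a \<in> carrier R \<and>
     (\<exists>r e. von_neumann_regular R r \<and> idempotent_elem R e \<and>
        a = r \<oplus>\<^bsub>R\<^esub> e \<and> r \<otimes>\<^bsub>R\<^esub> e = e \<otimes>\<^bsub>R\<^esub> r)"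

definition strongly_r_clean_ring :: "('a, 'm) ring_scheme \<Rightarrow> bool" where
  "strongly_r_clean_ring R \<longleftrightarrow> ring R \<and> (\<forall>a\<in>carrier R. strongly_r_clean_elem R a)"

end

theory Submission
  imports Defs "HOL-Computational_Algebra.Polynomial"
begin

text \<open>Evaluation of real polynomials at a matrix \<open>A\<close> has a nonzero polynomial \<open>p\<close> in its kernel,
  because its entries take values in a finite-dimensional real space. Writing
  \<open>p = X\<^sup>k q\<close> with \<open>q(0) \<noteq> 0\<close> gives \<open>X\<^sup>k \<equiv> X\<^bsup>k+1\<^esup> g\<close> modulo \<open>p\<close>. Then \<open>f = (X g)\<^sup>k\<close> is idempotent
  modulo \<open>p\<close>; \<open>X\<close> is invertible on the \<open>f\<close>-component and nilpotent on the \<open>(1 - f)\<close>-component, so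
  \<open>X - (1 - f)\<close> is a unit modulo \<open>p\<close>, and evaluating at \<open>A\<close> gives the decomposition of \<open>A\<close>.\<close>

text \<open>Working modulo \<open>p\<close> is expressed by divisibility, so no quotient ring is
  built. For \<open>k = 0\<close> the assumption says that \<open>x\<close> is a unit modulo
  \<open>p\<close>, and \<open>e\<close> is 0.\<close>

lemma strongly_clean_modulo:
  fixes p x g :: "'a :: comm_ring_1"
  assumes "p dvd x ^ k - x ^ Suc k * g"
  obtains r e y where "x = r + e" "p dvd e * e - e" "p dvd r * y - 1"
proof -
  define f where "f = (x * g) ^ k"
  define e where "e = 1 - f"
  define S where "S = (\<Sum>i<k. x ^ i)"
  have base: "p dvd x ^ k * (1 - x * g)"
    using assms by (simp add: algebra_simps)
  \<comment> \<open>The factor \<open>1 - x * g\<close> of \<open>e\<close> lets \<open>base\<close>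
    give that \<open>x ^ k * e\<close> is 0 modulo \<open>p\<close>: \<open>x\<close> is nilpotent
    on the \<open>e\<close>-component.\<close>
  have "e = (1 - x * g) * (\<Sum>i<k. (x * g) ^ i)"
    unfolding e_def f_def by (rule one_diff_power_eq)
  then have "x ^ k * e = x ^ k * (1 - x * g) * (\<Sum>i<k. (x * g) ^ i)"
    by (simp add: mult.assoc)
  with base have xe: "p dvd x ^ k * e"
    by simp
  have fe: "f * e = x ^ k * e * g ^ k"
    by (simp add: f_def power_mult_distrib mult_ac)
  have "e * e - e = - (f * e)"
    by (simp add: e_def algebra_simps)
  with fe xe have ee: "p dvd e * e - e"
    by simp
  have geom: "x * S = x ^ k - 1 + S"
    using power_diff_1_eq[of x k] by (simp add: S_def algebra_simps)
  \<comment> \<open>The inverse is assembled from the two components modulo \<open>p\<close>: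
    \<open>g\<close> inverts \<open>x\<close> where \<open>f\<close> acts as 1, and
    \<open>- S\<close> inverts \<open>x - 1\<close> where \<open>x ^ k\<close> vanishes.\<close>
  have "(x - e) * (g * f - S * e) - 1
      = g * x * f - x * S * e - g * (f * e) + S * (e * e) - 1"
    by (simp add: algebra_simps)
  also have "\<dots> = - (x ^ k * (1 - x * g) * g ^ k) - x ^ k * e - g * (f * e) + S * (e * e - e)"
    unfolding geom by (simp add: e_def f_def power_mult_distrib algebra_simps)
  finally have "p dvd (x - e) * (g * f - S * e) - 1"
    using base xe ee fe by simp
  with ee show thesis
    by (intro that[of "x - e" e]) simp_all
qed

lemma poly_strongly_clean_modulo:
  fixes p :: "'a :: field poly"
  assumes "p \<noteq> 0"
  obtains r e y where "[:0, 1:] = r + e" "p dvd e * e - e" "p dvd r * y - 1"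
proof -
  obtain k q where p: "p = [:0, 1:] ^ k * q" and q: "\<not> [:0, 1:] dvd q"
    using order_decomp[OF assms, of 0] by auto
  obtain c q' where q': "q = pCons c q'"
    by (cases q)
  with q have "c \<noteq> 0"
    by (auto simp: dvd_iff_poly_eq_0 [of 0, simplified])
  \<comment> \<open>Normalising the constant coefficient \<open>c\<close> of \<open>q\<close> to 1
    exhibits the witness \<open>g\<close> as \<open>smult (- (1 / c)) q'\<close>.\<close>
  then have "smult (1 / c) q = 1 - [:0, 1:] * smult (- (1 / c)) q'"
    by (simp add: q' one_pCons)
  then have "smult (1 / c) p = [:0, 1:] ^ k * (1 - [:0, 1:] * smult (- (1 / c)) q')"
    by (simp add: p flip: mult_smult_right)
  also have "\<dots> = [:0, 1:] ^ k - [:0, 1:] ^ Suc k * smult (- (1 / c)) q'"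
    by (simp only: right_diff_distrib power_Suc2 mult_1_right mult.assoc)
  finally have "p dvd [:0, 1:] ^ k - [:0, 1:] ^ Suc k * smult (- (1 / c)) q'"
    by (metis dvd_refl dvd_smult)
  then show thesis
    by (rule strongly_clean_modulo) (rule that)
qed

text \<open>Polynomials form an infinite-dimensional space, so finitely many linear conditions leave
  a nonzero solution. The induction eliminates one functional at a time.\<close>

lemma common_kernel_poly:
  fixes h :: "'i \<Rightarrow> 'a :: field poly \<Rightarrow> 'a"
  assumes "finite I"
    and "\<And>t p q. t \<in> I \<Longrightarrow> h t (p + q) = h t p + h t q"
    and "\<And>t c p. t \<in> I \<Longrightarrow> h t (smult c p) = c * h t p"
  obtains p where "p \<noteq> 0" "\<And>t. t \<in> I \<Longrightarrow> h t p = 0"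
proof -
  have "\<exists>p. p \<noteq> 0 \<and> (\<forall>t\<in>I. h t p = 0)"
    using assms
  proof (induction I arbitrary: h rule: finite_induct)
    case empty
    show ?case
      by (intro exI[of _ 1]) simp
  next
    case (insert s I)
    note prems = insert.prems[OF insertI2]
    obtain p where p: "p \<noteq> 0" "\<forall>t\<in>I. h t p = 0"
      using insert.IH[of h, OF prems] by blast
    \<comment> \<open>Multiplication by \<open>m\<close> provides a second solution for
      \<open>I\<close>, of degree above that of \<open>p\<close> and hence independent of
      \<open>p\<close>. Applying the induction hypothesis to shifted functionals requires
      \<open>h\<close> to be arbitrary.\<close>
    define m where "m = monom (1 :: 'a) (Suc (degree p))"
    obtain q where q: "q \<noteq> 0" "\<forall>t\<in>I. h t (m * q) = 0"
      using insert.IH[of "\<lambda>t q. h t (m * q)"] by (auto simp: distrib_left prems)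
    have deg: "degree (m * q) > degree p"
      using q by (simp add: m_def degree_mult_eq degree_monom_eq)
    \<comment> \<open>The two terms cancel under \<open>h s\<close>. If \<open>h s p\<close> is
      nonzero, the leading term comes from \<open>m * q\<close>, so \<open>w\<close> is
      nonzero.\<close>
    define w where "w = smult (h s (m * q)) p + smult (- h s p) (m * q)"
    show ?case
    proof (cases "h s p = 0")
      case True
      with p show ?thesis
        by blast
    next
      case False
      with deg have "degree w = degree (smult (- h s p) (m * q))"
        unfolding w_def
        by (intro degree_add_eq_right) (simp add: le_less_trans[OF degree_smult_le])
      also have "\<dots> = degree (m * q)"
        using False by simp
      finally have "degree w = degree (m * q)" .
      with deg have "w \<noteq> 0"
        by auto
      moreover have "h t w = 0" if "t \<in> insert s I" for t
        using that p q unfolding w_def insert.prems(1)[OF that] insert.prems(2)[OF that]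
        by (auto simp: mult.commute)
      ultimately show ?thesis
        by blast
    qed
  qed
  with that show thesis
    by blast
qed

text \<open>This is Horner's scheme. Coefficients are real, not in \<open>'a\<close>, because
  splitting off the power of \<open>X\<close> needs a field.\<close>

definition mat_eval :: "'a :: {comm_ring_1, real_algebra_1} mat \<Rightarrow> real poly \<Rightarrow> 'a mat" where
  "mat_eval A p = fold_coeffs (\<lambda>c M. of_real c \<cdot>\<^sub>m 1\<^sub>m (dim_row A) + A * M) p
     (0\<^sub>m (dim_row A) (dim_row A))"

context
  fixes A :: "'a :: {comm_ring_1, real_algebra_1} mat" and n
  assumes A: "A \<in> carrier_mat n n"
begin

lemma mat_eval_0 [simp]: "mat_eval A 0 = 0\<^sub>m n n"
  using A by (simp add: mat_eval_def)

lemma mat_eval_pCons: "mat_eval A (pCons c p) = of_real c \<cdot>\<^sub>m 1\<^sub>m n + A * mat_eval A p"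
proof (cases "p = 0 \<and> c = 0")
  \<comment> \<open>Here \<open>pCons c p\<close> is 0, which \<open>fold_coeffs\<close> sends to
    its start value without a step; the recursion holds since both summands vanish.\<close>
  case True
  then show ?thesis
    using A by (auto simp: mat_eval_def)
next
  case False
  then show ?thesis
    using A by (cases "c = 0") (simp_all add: mat_eval_def)
qed

lemma mat_eval_closed [simp]: "mat_eval A p \<in> carrier_mat n n"
  using A by (induction p) (auto simp: mat_eval_pCons)

lemma mat_eval_X: "mat_eval A [:0, 1:] = A"
  using A by (auto simp: mat_eval_pCons intro!: eq_matI)

lemma mat_eval_add: "mat_eval A (p + q) = mat_eval A p + mat_eval A q"
proof (induction p q rule: poly_induct2)
  case 0
  then show ?case
    by simp
next
  case (pCons c p d q)
  define P Q where "P = A * mat_eval A p" and "Q = A * mat_eval A q"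
  have PQ: "P \<in> carrier_mat n n" "Q \<in> carrier_mat n n"
    unfolding P_def Q_def using A by (intro mult_carrier_mat[of _ n n]; simp)+
  have "A * (mat_eval A p + mat_eval A q) = P + Q"
    unfolding P_def Q_def using A by (intro mult_add_distrib_mat[of _ n n _ n]) simp_all
  with PQ show ?case
    by (auto simp: mat_eval_pCons pCons.IH simp flip: P_def Q_def intro!: eq_matI)
qed

lemma mat_eval_smult: "mat_eval A (smult c p) = of_real c \<cdot>\<^sub>m mat_eval A p"
proof (induction p)
  case 0
  then show ?case
    by simp
next
  case (pCons d p)
  define P where "P = A * mat_eval A p"
  have P: "P \<in> carrier_mat n n"
    unfolding P_def using A by (intro mult_carrier_mat[of _ n n]) simp_all
  have "A * (of_real c \<cdot>\<^sub>m mat_eval A p) = of_real c \<cdot>\<^sub>m P"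
    unfolding P_def using A by (intro mult_smult_distrib[of _ n n _ n]) simp_all
  with P show ?case
    by (auto simp: mat_eval_pCons pCons.IH distrib_left simp flip: P_def intro!: eq_matI)
qed

text \<open>Multiplicativity carries the commutativity of polynomials over to matrices: all values
  of \<open>mat_eval A\<close> commute.\<close>

lemma mat_eval_mult: "mat_eval A (p * q) = mat_eval A p * mat_eval A q"
proof (induction p)
  case 0
  then show ?case
    by (simp add: left_mult_zero_mat[of _ n n])
next
  case (pCons c p)
  define P where "P = A * mat_eval A p"
  have P: "P \<in> carrier_mat n n"
    unfolding P_def using A by (intro mult_carrier_mat[of _ n n]) simp_all
  have assoc: "A * (mat_eval A p * mat_eval A q) = P * mat_eval A q"
    unfolding P_def using A by (intro assoc_mult_mat[symmetric, of _ n n _ n _ n]) simp_all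
  \<comment> \<open>Expanding \<open>pCons c p * q\<close> leaves a polynomial with constant
    coefficient 0, whose value contains a zero matrix that must be cleared.\<close>
  have "P * mat_eval A q \<in> carrier_mat n n"
    using P by (intro mult_carrier_mat[of _ n n]) simp_all
  then have "0 \<cdot>\<^sub>m 1\<^sub>m n + P * mat_eval A q = P * mat_eval A q"
    using P carrier_matD[OF mat_eval_closed[of q]] by (intro eq_matI) auto
  then have "mat_eval A (pCons c p * q) = of_real c \<cdot>\<^sub>m mat_eval A q + P * mat_eval A q"
    by (simp add: mat_eval_add mat_eval_smult mat_eval_pCons pCons.IH assoc)
  also have "\<dots> = (of_real c \<cdot>\<^sub>m 1\<^sub>m n + P) * mat_eval A q"
    using P by (simp add: add_mult_distrib_mat[of _ n n _ _ n] mult_smult_assoc_mat[of _ n n _ n]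
        left_mult_one_mat[of _ n n])
  finally show ?case
    by (simp add: mat_eval_pCons P_def)
qed

text \<open>Evaluation is a ring homomorphism killing \<open>p\<close>, so it factors through the
  quotient by \<open>p\<close>.\<close>

lemma mat_eval_cong:
  assumes "mat_eval A p = 0\<^sub>m n n" "p dvd q - q'"
  shows "mat_eval A q = mat_eval A q'"
proof -
  obtain s where "q = q' + p * s"
    using assms(2) by (metis dvdE diff_add_cancel add.commute)
  then show ?thesis
    using assms(1)
    by (simp add: mat_eval_add mat_eval_mult left_mult_zero_mat[of _ n n] right_add_zero_mat[of _ n n])
qed

lemma strongly_r_clean_elem_mat:
  assumes "mat_eval A p = 0\<^sub>m n n" "p \<noteq> 0"
  shows "strongly_r_clean_elem (ring_mat TYPE('a) n b) A"
proof -
  obtain r e y where X: "[:0, 1:] = r + e" and e: "p dvd e * e - e" and r: "p dvd r * y - 1"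
    using poly_strongly_clean_modulo[OF assms(2)] by blast
  \<comment> \<open>A unit is von Neumann regular, with its inverse \<open>y\<close> as the
    witness.\<close>
  have "p dvd (r * y - 1) * r"
    using r by simp
  then have "p dvd r - r * y * r"
    by (subst dvd_diff_commute) (simp add: left_diff_distrib)
  then have "mat_eval A r = mat_eval A r * mat_eval A y * mat_eval A r"
    unfolding mat_eval_mult[symmetric] by (rule mat_eval_cong[OF assms(1)])
  moreover have "mat_eval A e * mat_eval A e = mat_eval A e"
    using mat_eval_cong[OF assms(1) e] by (simp add: mat_eval_mult)
  moreover have "A = mat_eval A r + mat_eval A e"
    using mat_eval_X by (simp add: X mat_eval_add)
  moreover have "mat_eval A r * mat_eval A e = mat_eval A e * mat_eval A r"
    by (simp add: mult.commute flip: mat_eval_mult)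
  ultimately show ?thesis
    unfolding strongly_r_clean_elem_def von_neumann_regular_def idempotent_elem_def ring_mat_simps
    using A mat_eval_closed by blast
qed

end

text \<open>The value at \<open>A\<close> has \<open>2 * n * n\<close> real coordinates, each linear
  in the polynomial. The characteristic polynomial would not do, as its coefficients may fail to be
  real.\<close>

lemma dual_mat_algebraic:
  fixes A :: "dual_number mat"
  assumes A: "A \<in> carrier_mat n n"
  obtains p where "p \<noteq> 0" "mat_eval A p = 0\<^sub>m n n"
proof -
  define h where "h = (\<lambda>(i, j, b) p. (if b then std_part else eps_part) (mat_eval A p $$ (i, j)))"
  let ?I = "{..<n} \<times> {..<n} \<times> (UNIV :: bool set)"
  note closed = mat_eval_closed[OF A]
  have "finite ?I"
    by simp
  moreover have "h t (p + q) = h t p + h t q" if "t \<in> ?I" for t p q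
    using that closed[of p] closed[of q]
    by (auto simp: h_def mat_eval_add[OF A] plus_dual_number_def)
  moreover have "h t (smult c p) = c * h t p" if "t \<in> ?I" for t c p
    using that closed[of p]
    by (auto simp: h_def mat_eval_smult[OF A] of_real_def scaleR_dual_number_def
        one_dual_number_def times_dual_number_def)
  ultimately obtain p where p: "p \<noteq> 0" "\<And>t. t \<in> ?I \<Longrightarrow> h t p = 0"
    using common_kernel_poly[of ?I h] by blast
  have "mat_eval A p $$ (i, j) = 0" if "i < n" "j < n" for i j
    using that p(2)[of "(i, j, True)"] p(2)[of "(i, j, False)"]
    by (simp add: h_def dual_number_eq_iff zero_dual_number_def)
  with closed[of p] have "mat_eval A p = 0\<^sub>m n n"
    by (auto intro!: eq_matI)
  with p(1) show thesis
    by (rule that)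
qed

theorem corollary4p9:
  fixes n :: nat
  assumes "n \<ge> 1"
  shows "strongly_r_clean_ring (ring_mat TYPE(dual_number) n ())"
  unfolding strongly_r_clean_ring_def
proof (intro conjI ballI)
  show "ring (ring_mat TYPE(dual_number) n ())"
    by (rule ring_mat)
next
  fix A
  assume "A \<in> carrier (ring_mat TYPE(dual_number) n ())"
  then have A: "A \<in> carrier_mat n n"
    by (simp add: ring_mat_simps)
  obtain p where "p \<noteq> 0" "mat_eval A p = 0\<^sub>m n n"
    using dual_mat_algebraic[OF A] by blast
  then show "strongly_r_clean_elem (ring_mat TYPE(dual_number) n ()) A"
    by (intro strongly_r_clean_elem_mat[OF A])
qed

end
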